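(* Let $f=f(x_1,\dots,x_p)$ be a tensor product spline on $[0,1]^p$ with coefficient vector $b\in\mathbb{R}^D$ with respect to the tensor product B-splines. (1) For every $j\in\{1,\dots,p\}$, the main effect of $x_j$, i.e. the function $x_j\mapsto\int_{[0,1]^{p-1}}f(x_1,\dots,x_p)\,dx_{-j}$, is in the span of the $j$-th marginal B-spline basis and its coefficients with respect to this basis are $$(A_1\otimes\dots\otimes A_{j-1}\otimes I_{d_j}\otimes A_{j+1}\otimes\dots\otimes A_p)\,b.$$ (2) For all $1\le j<k\le p$, the two-dimensional interaction of $x_j$ and $x_k$, i.e. the function $(x_j,x_k)\mapsto\int_{[0,1]^{p-2}}f(x_1,\dots,x_p)\,dx_{-(j,k)}$, is in the tensor product space spanned by the $j$-th and $k$-th marginal B-spline bases and its coefficients with respect to the corresponding tensor product B-splines are $$(A_1\otimes\dots\otimes A_{j-1}\otimes I_{d_j}\otimes A_{j+1}\otimes\dots\otimes A_{k-1}\otimes I_{d_k}\otimes A_{k+1}\otimes\dots\otimes A_p)\,b.$$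
   Context: Let $p\geq 2$. For each $j=1,\dots,p$ let $B^{(j)}_1,\dots,B^{(j)}_{d_j}$ be the $j$-th marginal basis: a cubic B-spline basis of dimension $d_j$ on the unit interval $[0,1]$ with equidistant knots (a linearly independent family of continuous functions on $[0,1]$). Let $D=\prod_{j=1}^p d_j$. The tensor product B-splines are the $D$ functions on $[0,1]^p$ $$x\mapsto\prod_{j=1}^pB^{(j)}_{l_j}(x_j),\qquad 1\le l_j\le d_j,$$ enumerated in lexicographic order of $(l_1,\dots,l_p)$ with the last index $l_p$ varying fastest (consistent with the Kronecker product $\otimes$). A tensor product spline is a linear combination $f=\sum_{l=1}^D b_lB_l$ of the tensor product B-splines $B_1,\dots,B_D$ so enumerated, and $b\in\mathbb{R}^D$ is its coefficient vector. The tensor product space spanned by the $j$-th and $k$-th marginal bases ($j<k$) has the tensor product B-splines $(x_j,x_k)\mapsto B^{(j)}_{l}(x_j)B^{(k)}_{m}(x_k)$, enumerated lexicographically in $(l,m)$. $A_j$ is the $1\times d_j$ matrix $$A_j=\left(\int_{[0,1]}B^{(j)}_1(x_j)\,dx_j,\ \dots,\ \int_{[0,1]}B^{(j)}_{d_j}(x_j)\,dx_j\right),$$ $I_d$ is the $d\times d$ identity matrix, $x_{-j}$ denotes $x=(x_1,\dots,x_p)$ without its $j$-th component, and $x_{-(j,k)}$ denotes $x$ without its $j$-th and $k$-th components (for $p=2$ the integral over $[0,1]^{0}$ is just evaluation, so the interaction is $f$ itself). *)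

theory Defs
  imports "HOL-Analysis.Analysis" "Jordan_Normal_Form.Matrix"
begin

text \<open>
  Everything is indexed from 0: the coordinates are \<open>0, \<dots>, p - 1\<close>, and a B-spline basis of
  dimension \<open>d\<close> has the indices \<open>0, \<dots>, d - 1\<close>. Vectors and matrices are those of
  \<open>Jordan_Normal_Form\<close>, whose dimensions are natural numbers; their names are qualified
  because of the clash with \<open>real ^ 'n\<close>.
\<close>

subsection \<open>Cubic B-splines with equidistant knots\<close>

text \<open>The Cox--de Boor recursion for the \<open>i\<close>-th B-spline of degree \<open>k\<close> over the knots \<open>t\<close>.\<close>

fun bspline :: "(nat \<Rightarrow> real) \<Rightarrow> nat \<Rightarrow> nat \<Rightarrow> real \<Rightarrow> real" where
  "bspline t 0 i x = (if t i \<le> x \<and> x < t (i + 1) then 1 else 0)"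
| "bspline t (Suc k) i x =
     (x - t i) / (t (i + k + 1) - t i) * bspline t k i x
   + (t (i + k + 2) - x) / (t (i + k + 2) - t (i + 1)) * bspline t k (i + 1) x"

text \<open>
  A cubic basis of dimension \<open>d \<ge> 4\<close> splits \<open>[0,1]\<close> into \<open>d - 3\<close> intervals of equal length.
  All \<open>d + 4\<close> knots are equidistant, so that three of them lie on either side of \<open>[0,1]\<close>:
  knot number 3 is \<open>0\<close> and knot number \<open>d\<close> is \<open>1\<close>.
\<close>

definition knot :: "nat \<Rightarrow> nat \<Rightarrow> real" where
  "knot d i = (real i - 3) / (real d - 3)"

definition cubic_bspline :: "nat \<Rightarrow> nat \<Rightarrow> real \<Rightarrow> real" where
  "cubic_bspline d l = bspline (knot d) 3 l"

subsection \<open>Tensor product B-splines\<close>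

text \<open>
  A point with coordinates in \<open>I\<close> is a function in the extensional product over \<open>I\<close>,
  as for the product measure \<open>Pi\<^sub>M\<close>.
\<close>

definition unit_cube :: "nat set \<Rightarrow> (nat \<Rightarrow> real) set" where
  "unit_cube I = (\<Pi>\<^sub>E i\<in>I. {0..1})"

text \<open>
  \<^const>\<open>product_lists\<close> and \<^const>\<open>List.product\<close> enumerate lexicographically, the last
  index varying fastest.
\<close>

definition multi_indices :: "nat \<Rightarrow> (nat \<Rightarrow> nat) \<Rightarrow> nat list list" where
  "multi_indices p d = product_lists (map (\<lambda>j. [0..<d j]) [0..<p])"

definition tp_bspline :: "nat \<Rightarrow> (nat \<Rightarrow> nat) \<Rightarrow> nat \<Rightarrow> (nat \<Rightarrow> real) \<Rightarrow> real" where
  "tp_bspline p d l x = (\<Prod>j<p. cubic_bspline (d j) (multi_indices p d ! l ! j) (x j))"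

definition tp_bspline2 :: "nat \<Rightarrow> nat \<Rightarrow> nat \<Rightarrow> real \<times> real \<Rightarrow> real" where
  "tp_bspline2 d e i = (\<lambda>(s, t). case List.product [0..<d] [0..<e] ! i of
     (l, m) \<Rightarrow> cubic_bspline d l s * cubic_bspline e m t)"

subsection \<open>Coefficients of a function on \<open>S\<close> with respect to a finite family of functions\<close>

definition expansion_on ::
  "'a set \<Rightarrow> nat \<Rightarrow> (nat \<Rightarrow> 'a \<Rightarrow> real) \<Rightarrow> ('a \<Rightarrow> real) \<Rightarrow> real Matrix.vec \<Rightarrow> bool" where
  "expansion_on S n B g c \<longleftrightarrow>
     c \<in> carrier_vec n \<and> (\<forall>x\<in>S. g x = (\<Sum>l<n. vec_index c l * B l x))"

definition in_span_on ::
  "'a set \<Rightarrow> nat \<Rightarrow> (nat \<Rightarrow> 'a \<Rightarrow> real) \<Rightarrow> ('a \<Rightarrow> real) \<Rightarrow> bool" where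
  "in_span_on S n B g \<longleftrightarrow> (\<exists>c. expansion_on S n B g c)"

text \<open>The coefficients of \<open>g\<close> are \<open>c\<close>: an expansion with \<open>c\<close> exists, and it is the only one.\<close>

definition has_coefficients_on ::
  "'a set \<Rightarrow> nat \<Rightarrow> (nat \<Rightarrow> 'a \<Rightarrow> real) \<Rightarrow> ('a \<Rightarrow> real) \<Rightarrow> real Matrix.vec \<Rightarrow> bool" where
  "has_coefficients_on S n B g c \<longleftrightarrow> (\<forall>c'. expansion_on S n B g c' \<longleftrightarrow> c' = c)"

subsection \<open>Main effects and two-dimensional interactions\<close>

definition cube_integral :: "nat set \<Rightarrow> ((nat \<Rightarrow> real) \<Rightarrow> real) \<Rightarrow> real" where
  "cube_integral I g = (LINT y:unit_cube I|(\<Pi>\<^sub>M i\<in>I. lborel). g y)"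

definition main_effect :: "nat \<Rightarrow> ((nat \<Rightarrow> real) \<Rightarrow> real) \<Rightarrow> nat \<Rightarrow> real \<Rightarrow> real" where
  "main_effect p f j t = cube_integral ({..<p} - {j}) (\<lambda>y. f (y(j := t)))"

definition interaction ::
  "nat \<Rightarrow> ((nat \<Rightarrow> real) \<Rightarrow> real) \<Rightarrow> nat \<Rightarrow> nat \<Rightarrow> real \<times> real \<Rightarrow> real" where
  "interaction p f j k =
     (\<lambda>(s, t). cube_integral ({..<p} - {j, k}) (\<lambda>y. f (y(j := s, k := t))))"

subsection \<open>Kronecker products\<close>

definition kronecker :: "real mat \<Rightarrow> real mat \<Rightarrow> real mat" where
  "kronecker M N = Matrix.mat (dim_row M * dim_row N) (dim_col M * dim_col N)
     (\<lambda>(i, j). index_mat M (i div dim_row N, j div dim_col N)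
             * index_mat N (i mod dim_row N, j mod dim_col N))"

definition kronecker_list :: "real mat list \<Rightarrow> real mat" where
  "kronecker_list Ms = foldr kronecker Ms (1\<^sub>m 1)"

definition integral_row :: "nat \<Rightarrow> real mat" where
  "integral_row d = Matrix.mat 1 d (\<lambda>(_, l). LINT x:{0..1}|lborel. cubic_bspline d l x)"

text \<open>The Kronecker product with factor \<open>I\<close> at the positions in \<open>J\<close> and \<open>A\<close> elsewhere.\<close>

definition effect_matrix :: "nat \<Rightarrow> (nat \<Rightarrow> nat) \<Rightarrow> nat set \<Rightarrow> real mat" where
  "effect_matrix p d J =
     kronecker_list (map (\<lambda>i. if i \<in> J then 1\<^sub>m (d i) else integral_row (d i)) [0..<p])"

end

theory Submission
  imports Defs
begin

text \<open>
  By Fubini, integrating a tensor product B-spline over the coordinates outside \<open>J\<close> replaces the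
  factors outside \<open>J\<close> by entries of the rows \<open>A\<^sub>i\<close>. The lexicographic position of a multi-index is
  the number whose mixed-radix digits are its components, and the entries of a Kronecker product are
  products over digits. Padding the row indices with radix 1 outside \<open>J\<close>, a sum over rows factorizes
  into sums over digits, where the factors \<open>I\<close> pick out the right B-splines. The coefficients are
  unique because the four cubic B-splines that live on one knot interval are independent there:
  evaluation at four points gives a regular linear system.
\<close>

subsection \<open>Mixed-radix digits\<close>

text \<open>Digit number \<open>i\<close> of \<open>r\<close> in the mixed radix \<open>ns\<close>, the last digit being the least significant one.\<close>

definition digit :: "nat list \<Rightarrow> nat \<Rightarrow> nat \<Rightarrow> nat" where
  "digit ns r i = r div prod_list (drop (Suc i) ns) mod (ns ! i)"

lemma digit_Cons_0: "r < n * prod_list ns \<Longrightarrow> digit (n # ns) r 0 = r div prod_list ns"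
  by (simp add: digit_def less_mult_imp_div_less)

lemma digit_Cons_Suc [simp]: "digit (n # ns) r (Suc i) = digit ns r i"
  by (simp add: digit_def)

text \<open>\<open>prod_list ns\<close> is a multiple of the weight of digit \<open>i\<close> times
  its radix, so the reduction affects only more significant positions.\<close>

lemma digit_mod:
  assumes "i < length ns"
  shows "digit ns (r mod prod_list ns) i = digit ns r i"
proof -
  define Q where "Q = prod_list (drop (Suc i) ns)"
  have "ns = take i ns @ ns ! i # drop (Suc i) ns"
    using assms by (rule id_take_nth_drop)
  then have "prod_list ns = prod_list (take i ns @ ns ! i # drop (Suc i) ns)"
    by simp
  then have P: "prod_list ns = Q * (ns ! i * prod_list (take i ns))"
    by (simp add: Q_def mult_ac)
  \<comment> \<open>For \<open>Q = 0\<close> both quotients are 0 by convention.\<close>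
  have "r mod prod_list ns div Q mod (ns ! i) = r div Q mod (ns ! i)"
  proof (cases "Q = 0")
    case False
    then have "r mod prod_list ns div Q = r div Q mod (ns ! i * prod_list (take i ns))"
      unfolding P mod_mult2_eq by simp
    then show ?thesis
      by (simp add: mod_mod_cancel)
  qed simp
  then show ?thesis
    by (simp add: digit_def Q_def)
qed

lemma digit_less: "0 < ns ! i \<Longrightarrow> digit ns r i < ns ! i"
  by (simp add: digit_def)

text \<open>Division with remainder by \<open>k\<close> is a bijection from
  \<open>{..<n * k}\<close> onto the pairs \<open>(q, s)\<close>. It serves to split off the leading
  digit of an index.\<close>

lemma sum_lessThan_mult:
  fixes F :: "nat \<Rightarrow> nat \<Rightarrow> 'a :: comm_monoid_add"
  shows "(\<Sum>r<n * k. F (r div k) (r mod k)) = (\<Sum>q<n. \<Sum>s<k. F q s)"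
proof -
  have "(\<Sum>r<n * k. F (r div k) (r mod k)) = (\<Sum>(q, s)\<in>{..<n} \<times> {..<k}. F q s)"
  proof (rule sum.reindex_bij_witness[where i = "\<lambda>(q, s). q * k + s" and j = "\<lambda>r. (r div k, r mod k)"])
    fix qs assume "qs \<in> {..<n} \<times> {..<k}"
    then obtain q s where [simp]: "qs = (q, s)" and qs: "q < n" "s < k" by auto
    have "q * k + s < Suc q * k" using qs by simp
    also have "\<dots> \<le> n * k" using qs by (intro mult_right_mono) auto
    finally show "(case qs of (q, s) \<Rightarrow> q * k + s) \<in> {..<n * k}" by simp
    show "(\<lambda>r. (r div k, r mod k)) (case qs of (q, s) \<Rightarrow> q * k + s) = qs"
      using qs by simp
  next
    fix r assume r: "r \<in> {..<n * k}"
    then have "0 < k" by (cases k) auto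
    with r show "(r div k, r mod k) \<in> {..<n} \<times> {..<k}"
      by (auto simp: less_mult_imp_div_less)
  qed auto
  then show ?thesis
    by (simp add: sum.cartesian_product)
qed

text \<open>Distributive law: as \<open>r\<close> runs, its digits run through all tuples exactly
  once. The induction peels off the leading digit.\<close>

lemma sum_prod_digit:
  fixes g :: "nat \<Rightarrow> nat \<Rightarrow> 'a :: comm_semiring_1"
  shows "(\<Sum>r<prod_list ns. \<Prod>i<length ns. g i (digit ns r i)) = (\<Prod>i<length ns. \<Sum>m<ns ! i. g i m)"
proof (induction ns arbitrary: g)
  case (Cons n ns)
  let ?P = "prod_list ns"
  have "(\<Sum>r<prod_list (n # ns). \<Prod>i<length (n # ns). g i (digit (n # ns) r i))
      = (\<Sum>r<n * ?P. g 0 (r div ?P) * (\<Prod>i<length ns. g (Suc i) (digit ns (r mod ?P) i)))"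
    by (auto intro!: sum.cong simp: prod.lessThan_Suc_shift digit_Cons_0 digit_mod simp del: prod.lessThan_Suc)
  also have "\<dots> = (\<Sum>q<n. \<Sum>s<?P. g 0 q * (\<Prod>i<length ns. g (Suc i) (digit ns s i)))"
    by (rule sum_lessThan_mult)
  also have "\<dots> = (\<Sum>q<n. g 0 q) * (\<Sum>s<?P. \<Prod>i<length ns. g (Suc i) (digit ns s i))"
    by (simp add: sum_product)
  also have "\<dots> = (\<Prod>i<length (n # ns). \<Sum>m<(n # ns) ! i. g i m)"
    using Cons.IH[of "\<lambda>i. g (Suc i)"] by (simp add: prod.lessThan_Suc_shift del: prod.lessThan_Suc)
  finally show ?case .
qed simp

section \<open>Lexicographic positions of multi-indices\<close>

lemma nth_concat_map:
  assumes "\<And>x. x \<in> set xs \<Longrightarrow> length (f x) = n" and "r < length xs * n"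
  shows "concat (map f xs) ! r = f (xs ! (r div n)) ! (r mod n)"
  using assms
proof (induction xs arbitrary: r)
  case (Cons x xs)
  show ?case
  proof (cases "r < n")
    case True
    then show ?thesis using Cons.prems by (simp add: nth_append)
  next
    case False
    moreover have "0 < n" using Cons.prems(2) by (cases n) auto
    ultimately show ?thesis
      using Cons by (simp add: nth_append le_div_geq le_mod_geq)
  qed
qed simp

lemma length_product_lists_upt:
  "length (product_lists (map (\<lambda>n. [0..<n]) ns)) = prod_list ns"
  by (simp add: length_product_lists foldr_map o_def prod_list.eq_foldr)

text \<open>\<open>product_lists\<close> puts each first index in front of the whole enumeration of
  the rest. This gives blocks of equal length: the leading digit of \<open>r\<close> counts blocks,
  the remainder is the position inside one.\<close>

lemma product_lists_upt_nth:
  assumes "r < prod_list ns" and "i < length ns"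
  shows "product_lists (map (\<lambda>n. [0..<n]) ns) ! r ! i = digit ns r i"
  using assms
proof (induction ns arbitrary: r i)
  case (Cons n ns)
  let ?P = "prod_list ns" and ?L = "product_lists (map (\<lambda>n. [0..<n]) ns)"
  have r: "r < n * ?P" using Cons.prems by simp
  then have "0 < ?P" by (cases ?P) auto
  then have m: "r mod ?P < ?P" by simp
  have "product_lists (map (\<lambda>n. [0..<n]) (n # ns)) ! r
      = map ((#) ([0..<n] ! (r div ?P))) ?L ! (r mod ?P)"
    using r by (simp add: nth_concat_map length_product_lists_upt)
  also have "\<dots> = (r div ?P) # ?L ! (r mod ?P)"
    using r m by (simp add: length_product_lists_upt less_mult_imp_div_less)
  finally show ?case
    using Cons.prems Cons.IH[OF m] digit_Cons_0[OF r] by (cases i) (auto simp: digit_mod)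
qed simp

lemma prod_list_map_upt: "prod_list (map d [0..<p]) = (\<Prod>j<p. d j)"
  by (simp add: prod.list_conv_set_nth atLeast0LessThan)

lemma multi_indices_nth:
  assumes "c < (\<Prod>j<p. d j)" and "i < p"
  shows "multi_indices p d ! c ! i = digit (map d [0..<p]) c i"
proof -
  have "multi_indices p d = product_lists (map (\<lambda>n. [0..<n]) (map d [0..<p]))"
    by (simp add: multi_indices_def o_def)
  then show ?thesis
    using assms by (simp add: product_lists_upt_nth prod_list_map_upt del: map_map)
qed

subsection \<open>Entries of Kronecker products\<close>

lemma dim_row_kronecker_list: "dim_row (kronecker_list Ms) = prod_list (map dim_row Ms)"
  by (induction Ms) (simp_all add: kronecker_list_def kronecker_def)

lemma dim_col_kronecker_list: "dim_col (kronecker_list Ms) = prod_list (map dim_col Ms)"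
  by (induction Ms) (simp_all add: kronecker_list_def kronecker_def)

text \<open>\<open>kronecker\<close> divides each index with remainder by the size of the right
  factor; since the product nests to the right, the quotients are the successive leading
  digits.\<close>

lemma index_kronecker_list:
  assumes "r < prod_list (map dim_row Ms)" and "c < prod_list (map dim_col Ms)"
  shows "index_mat (kronecker_list Ms) (r, c)
    = (\<Prod>i<length Ms. index_mat (Ms ! i) (digit (map dim_row Ms) r i, digit (map dim_col Ms) c i))"
  using assms
proof (induction Ms arbitrary: r c)
  case Nil
  then show ?case by (simp add: kronecker_list_def)
next
  case (Cons M Ms)
  let ?P = "prod_list (map dim_row Ms)" and ?Q = "prod_list (map dim_col Ms)"
  have rc: "r < dim_row M * ?P" "c < dim_col M * ?Q"
    using Cons.prems by simp_all
  then have "0 < ?P" "0 < ?Q" by (cases ?P; cases ?Q; simp)+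
  then have m: "r mod ?P < ?P" "c mod ?Q < ?Q" by simp_all
  have "kronecker_list (M # Ms) = kronecker M (kronecker_list Ms)"
    by (simp add: kronecker_list_def)
  then have "index_mat (kronecker_list (M # Ms)) (r, c)
      = index_mat M (r div ?P, c div ?Q) * index_mat (kronecker_list Ms) (r mod ?P, c mod ?Q)"
    using rc by (simp add: kronecker_def dim_row_kronecker_list dim_col_kronecker_list)
  then show ?case
    using rc by (simp add: Cons.IH[OF m] prod.lessThan_Suc_shift digit_Cons_0 digit_mod del: prod.lessThan_Suc)
qed

subsection \<open>Integrals of tensor product splines\<close>

text \<open>Unapplied form of the recursion, for places where \<open>bspline\<close> occurs as a
  function.\<close>

lemma bspline_Suc:
  "bspline t (Suc k) i = (\<lambda>x. (x - t i) / (t (i + k + 1) - t i) * bspline t k i x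
    + (t (i + k + 2) - x) / (t (i + k + 2) - t (i + 1)) * bspline t k (i + 1) x)"
  by (simp add: fun_eq_iff)

declare bspline.simps(2) [simp del]

lemma borel_measurable_bspline [measurable]: "bspline t k i \<in> borel_measurable borel"
proof (induction k arbitrary: i)
  case 0
  have "bspline t 0 i = indicator {t i..<t (i + 1)}"
    by (auto simp: fun_eq_iff indicator_def)
  then show ?case by simp
next
  case (Suc k)
  note [measurable] = Suc[of i] Suc[of "i + 1"]
  show ?case unfolding bspline_Suc by measurable
qed

text \<open>Boundedness, unlike continuity, holds already in degree 0 and passes through the
  recursion, as affine factors are bounded on a compact interval. For coinciding knots, division by
  0 makes the factor 0.\<close>

lemma bounded_bspline: "bounded (bspline t k i ` {a..b})"
proof (induction k arbitrary: i)
  case 0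
  show ?case
    by (rule boundedI[of _ 1]) auto
next
  case (Suc k)
  have times: "bounded ((\<lambda>x. f x * g x) ` {a..b})"
    if "bounded (f ` {a..b})" "bounded (g ` {a..b})" for f g :: "real \<Rightarrow> real"
  proof -
    obtain C D where "\<And>x. x \<in> {a..b} \<Longrightarrow> norm (f x) \<le> C" "\<And>x. x \<in> {a..b} \<Longrightarrow> norm (g x) \<le> D"
      using \<open>bounded (f ` {a..b})\<close> \<open>bounded (g ` {a..b})\<close> unfolding bounded_iff by blast
    then have "norm (f x * g x) \<le> C * D" if "x \<in> {a..b}" for x
      unfolding norm_mult using that by (intro mult_mono') auto
    then show ?thesis
      by (intro boundedI[of _ "C * D"]) auto
  qed
  have affine: "bounded ((\<lambda>x. (x - u) / v) ` {a..b})" "bounded ((\<lambda>x. (u - x) / v) ` {a..b})" for u v :: real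
    unfolding divide_inverse
    by (intro compact_imp_bounded compact_continuous_image continuous_intros compact_Icc)+
  show ?case
    unfolding bspline_Suc by (intro bounded_plus_comp times affine Suc)
qed

lemma set_integrable_bspline: "set_integrable lborel {a..b} (bspline t k i)"
proof -
  obtain C where C: "\<And>x. x \<in> {a..b} \<Longrightarrow> norm (bspline t k i x) \<le> C"
    using bounded_bspline[of t k i a b] unfolding bounded_iff by blast
  show ?thesis
    unfolding set_integrable_def using C
    by (intro integrableI_bounded_set_indicator[where B = C] AE_I2 impI)
      (auto simp: emeasure_lborel_Icc_eq)
qed

section \<open>Fubini on the unit cube\<close>

lemma unit_cube_indicator:
  assumes "finite I" and "y \<in> extensional I"
  shows "indicator (unit_cube I) y = (\<Prod>i\<in>I. indicator {0..1} (y i) :: real)"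
  using assms by (auto simp: unit_cube_def indicator_def PiE_def Pi_def)

text \<open>Distributing the indicator of the cube over the factors leaves a product of functions of
  one coordinate each, to which Fubini applies. The case \<open>I = {}\<close>, where the integral
  is 1, serves the interaction for \<open>p = 2\<close>.\<close>

lemma cube_integral_prod:
  assumes "finite I" and "\<And>i. i \<in> I \<Longrightarrow> set_integrable lborel {0..1} (h i)"
  shows "set_integrable (\<Pi>\<^sub>M i\<in>I. lborel) (unit_cube I) (\<lambda>y. \<Prod>i\<in>I. h i (y i))"
    and "cube_integral I (\<lambda>y. \<Prod>i\<in>I. h i (y i)) = (\<Prod>i\<in>I. LINT x:{0..1}|lborel. h i x)"
proof -
  interpret product_sigma_finite "\<lambda>_. lborel :: real measure" ..
  let ?g = "\<lambda>i x. indicator {0..1} x *\<^sub>R h i x"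
  have g: "\<And>i. i \<in> I \<Longrightarrow> integrable lborel (?g i)"
    using assms(2) by (simp add: set_integrable_def)
  have eq: "indicator (unit_cube I) y *\<^sub>R (\<Prod>i\<in>I. h i (y i)) = (\<Prod>i\<in>I. ?g i (y i))"
    if "y \<in> space (\<Pi>\<^sub>M i\<in>I. lborel)" for y
    using that assms(1) by (auto simp: space_PiM PiE_def unit_cube_indicator prod.distrib)
  show "set_integrable (\<Pi>\<^sub>M i\<in>I. lborel) (unit_cube I) (\<lambda>y. \<Prod>i\<in>I. h i (y i))"
    unfolding set_integrable_def
    using product_integrable_prod[OF assms(1) g] eq by (simp cong: Bochner_Integration.integrable_cong)
  show "cube_integral I (\<lambda>y. \<Prod>i\<in>I. h i (y i)) = (\<Prod>i\<in>I. LINT x:{0..1}|lborel. h i x)"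
    unfolding cube_integral_def set_lebesgue_integral_def
    using product_integral_prod[OF assms(1) g] eq by (simp cong: Bochner_Integration.integral_cong)
qed

text \<open>A set \<open>J\<close> of frozen coordinates with values \<open>z\<close> treats main
  effects and interactions alike. Factors in \<open>J\<close> are constants of the integration; the
  others fall under \<open>cube_integral_prod\<close>.\<close>

lemma cube_integral_tp_spline:
  assumes "expansion_on (unit_cube {..<p}) (\<Prod>j<p. d j) (tp_bspline p d) f b"
    and "J \<subseteq> {..<p}" and "\<And>i. i \<in> J \<Longrightarrow> z i \<in> {0..1}"
  shows "cube_integral ({..<p} - J) (\<lambda>y. f (\<lambda>i. if i \<in> J then z i else y i))
    = (\<Sum>c<\<Prod>j<p. d j. vec_index b c
        * (\<Prod>i<p. if i \<in> J then cubic_bspline (d i) (digit (map d [0..<p]) c i) (z i)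
            else LINT x:{0..1}|lborel. cubic_bspline (d i) (digit (map d [0..<p]) c i) x))"
proof -
  let ?I = "{..<p} - J" and ?D = "\<Prod>j<p. d j"
  define B where "B c i = cubic_bspline (d i) (digit (map d [0..<p]) c i)" for c i
  define K where "K c = vec_index b c * (\<Prod>i\<in>J. B c i (z i))" for c
  have split: "(\<Prod>i<p. if i \<in> J then u i else v i) = (\<Prod>i\<in>J. u i) * (\<Prod>i\<in>?I. v i)" for u v :: "nat \<Rightarrow> real"
    using assms(2) by (simp add: prod.If_cases Int_absorb1 Diff_eq)
  have f: "f (\<lambda>i. if i \<in> J then z i else y i) = (\<Sum>c<?D. K c * (\<Prod>i\<in>?I. B c i (y i)))"
    if y: "y \<in> unit_cube ?I" for y
  proof -
    let ?w = "\<lambda>i. if i \<in> J then z i else y i"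
    \<comment> \<open>\<open>f\<close> is known only on the cube, so the merged point must lie
      there, extensionality included.\<close>
    have "?w \<in> unit_cube {..<p}"
      using y assms(2,3) by (auto simp: unit_cube_def PiE_iff extensional_def subset_iff)
    then have "f ?w = (\<Sum>c<?D. vec_index b c * tp_bspline p d c ?w)"
      using assms(1) by (auto simp: expansion_on_def)
    also have "\<dots> = (\<Sum>c<?D. vec_index b c * (\<Prod>i<p. if i \<in> J then B c i (z i) else B c i (y i)))"
      unfolding tp_bspline_def
      by (intro sum.cong arg_cong2[where f = "(*)"] prod.cong refl) (simp_all add: multi_indices_nth B_def)
    finally show ?thesis
      by (simp add: split K_def mult.assoc)
  qed
  have B: "set_integrable lborel {0..1} (B c i)" for c i
    by (simp add: B_def cubic_bspline_def set_integrable_bspline)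
  have "unit_cube ?I \<in> sets (\<Pi>\<^sub>M i\<in>?I. lborel)"
    unfolding unit_cube_def by (intro sets_PiM_I_finite) auto
  then have "cube_integral ?I (\<lambda>y. f (\<lambda>i. if i \<in> J then z i else y i))
      = cube_integral ?I (\<lambda>y. \<Sum>c<?D. K c * (\<Prod>i\<in>?I. B c i (y i)))"
    unfolding cube_integral_def using f by (intro set_lebesgue_integral_cong) auto
  also have "\<dots> = (\<Sum>c<?D. K c * cube_integral ?I (\<lambda>y. \<Prod>i\<in>?I. B c i (y i)))"
  proof -
    let ?G = "\<lambda>c y. indicator (unit_cube ?I) y *\<^sub>R (\<Prod>i\<in>?I. B c i (y i))"
    \<comment> \<open>Integrability of every summand justifies exchanging sum and integral.\<close>
    have G: "integrable (\<Pi>\<^sub>M i\<in>?I. lborel) (?G c)" for c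
      using cube_integral_prod(1)[of ?I "B c"] B by (simp add: set_integrable_def)
    have "indicator (unit_cube ?I) y *\<^sub>R (\<Sum>c<?D. K c * (\<Prod>i\<in>?I. B c i (y i))) = (\<Sum>c<?D. K c * ?G c y)" for y
      by (simp add: sum_distrib_left mult.left_commute)
    then show ?thesis
      using G unfolding cube_integral_def set_lebesgue_integral_def
      by (subst Bochner_Integration.integral_sum[symmetric] integral_mult_right_zero[symmetric]) simp_all
  qed
  also have "\<dots> = (\<Sum>c<?D. K c * (\<Prod>i\<in>?I. LINT x:{0..1}|lborel. B c i x))"
    by (simp add: cube_integral_prod(2) B)
  finally show ?thesis
    by (simp add: split K_def mult.assoc B_def)
qed

subsection \<open>The effect matrix\<close>

text \<open>The row counts of the Kronecker factors: \<open>A_i\<close> has one row, so its digit is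
  always 0. Keeping these digits gives rows and columns the same \<open>p\<close> positions.\<close>

definition effect_dims :: "nat \<Rightarrow> (nat \<Rightarrow> nat) \<Rightarrow> nat set \<Rightarrow> nat list" where
  "effect_dims p d J = map (\<lambda>i. if i \<in> J then d i else 1) [0..<p]"

lemma length_effect_dims: "length (effect_dims p d J) = p"
  by (simp add: effect_dims_def)

lemma nth_effect_dims: "i < p \<Longrightarrow> effect_dims p d J ! i = (if i \<in> J then d i else 1)"
  by (simp add: effect_dims_def)

text \<open>For \<open>n = Suc i\<close> this is the weight of digit \<open>i\<close> of a row
  index, for \<open>n = 0\<close> the number of rows.\<close>

lemma prod_list_drop_effect_dims:
  "prod_list (drop n (effect_dims p d J)) = (\<Prod>i\<in>{n..<p} \<inter> J. d i)"
  by (simp add: effect_dims_def drop_map prod.If_cases flip: prod.distinct_set_conv_list)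

lemma dims_effect_matrix:
  defines "Ms p d J \<equiv> map (\<lambda>i. if i \<in> J then 1\<^sub>m (d i) else integral_row (d i)) [0..<p]"
  shows "map dim_row (Ms p d J) = effect_dims p d J" and "map dim_col (Ms p d J) = map d [0..<p]"
  by (auto simp: Ms_def effect_dims_def integral_row_def)

lemma effect_matrix_carrier:
  "effect_matrix p d J \<in> carrier_mat (prod_list (effect_dims p d J)) (\<Prod>j<p. d j)"
  unfolding effect_matrix_def
  by (rule carrier_matI)
    (simp_all add: dim_row_kronecker_list dim_col_kronecker_list dims_effect_matrix prod_list_map_upt del: map_map)

lemma index_effect_matrix:
  assumes "r < prod_list (effect_dims p d J)" and "c < (\<Prod>j<p. d j)" and "\<And>i. i < p \<Longrightarrow> 0 < d i"
  shows "index_mat (effect_matrix p d J) (r, c) =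
    (\<Prod>i<p. if i \<in> J then of_bool (digit (effect_dims p d J) r i = digit (map d [0..<p]) c i)
      else LINT x:{0..1}|lborel. cubic_bspline (d i) (digit (map d [0..<p]) c i) x)"
proof -
  let ?R = "effect_dims p d J" and ?C = "map d [0..<p]"
  let ?Ms = "map (\<lambda>i. if i \<in> J then 1\<^sub>m (d i) else integral_row (d i)) [0..<p]"
  have "index_mat (effect_matrix p d J) (r, c)
      = (\<Prod>i<length ?Ms. index_mat (?Ms ! i) (digit ?R r i, digit ?C c i))"
    using assms(1,2) index_kronecker_list[of r ?Ms c]
    unfolding effect_matrix_def dims_effect_matrix prod_list_map_upt by simp
  also have "\<dots> = (\<Prod>i<p. if i \<in> J then of_bool (digit ?R r i = digit ?C c i)
      else LINT x:{0..1}|lborel. cubic_bspline (d i) (digit ?C c i) x)"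
  proof (intro prod.cong)
    fix i assume i: "i \<in> {..<p}"
    \<comment> \<open>Matrix entries are specified only within the dimensions, so both digits must
      be in range.\<close>
    have "digit ?R r i < (if i \<in> J then d i else 1)" "digit ?C c i < d i"
      using i assms(3) digit_less[of ?R i r] digit_less[of ?C i c]
      by (cases "i \<in> J"; simp add: nth_effect_dims)+
    then show "index_mat (?Ms ! i) (digit ?R r i, digit ?C c i)
        = (if i \<in> J then of_bool (digit ?R r i = digit ?C c i)
           else LINT x:{0..1}|lborel. cubic_bspline (d i) (digit ?C c i) x)"
      using i by (cases "i \<in> J") (simp_all add: integral_row_def)
  qed simp
  finally show ?thesis .
qed

text \<open>Once the matrix-vector product is expanded and the sums are swapped,
  \<open>sum_prod_digit\<close> factorizes the sum over rows. What remains is the right-hand side of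
  \<open>cube_integral_tp_spline\<close>.\<close>

lemma effect_expansion:
  assumes "expansion_on (unit_cube {..<p}) (\<Prod>j<p. d j) (tp_bspline p d) f b"
    and "J \<subseteq> {..<p}" and "\<And>i. i \<in> J \<Longrightarrow> z i \<in> {0..1}" and pos: "\<And>i. i < p \<Longrightarrow> 0 < d i"
  shows "cube_integral ({..<p} - J) (\<lambda>y. f (\<lambda>i. if i \<in> J then z i else y i))
    = (\<Sum>r<prod_list (effect_dims p d J). vec_index (effect_matrix p d J *\<^sub>v b) r
        * (\<Prod>i\<in>J. cubic_bspline (d i) (digit (effect_dims p d J) r i) (z i)))"
proof -
  let ?R = "effect_dims p d J" and ?D = "\<Prod>j<p. d j"
  define e where "e c i = digit (map d [0..<p]) c i" for c i
  define A where "A c i = (LINT x:{0..1}|lborel. cubic_bspline (d i) (e c i) x)" for c i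
  \<comment> \<open>In \<open>J\<close>, the entry of the identity is joined with the B-spline of
    the same digit; elsewhere the factor does not depend on \<open>m\<close>.\<close>
  define g where "g c i m = (if i \<in> J then of_bool (m = e c i) * cubic_bspline (d i) m (z i) else A c i)"
    for c i m
  have b: "b \<in> carrier_vec ?D" using assms(1) by (simp add: expansion_on_def)
  have "vec_index (effect_matrix p d J *\<^sub>v b) r * (\<Prod>i\<in>J. cubic_bspline (d i) (digit ?R r i) (z i))
      = (\<Sum>c<?D. vec_index b c * (\<Prod>i<p. g c i (digit ?R r i)))" if r: "r < prod_list ?R" for r
  proof -
    have J: "(\<Prod>i\<in>J. cubic_bspline (d i) (digit ?R r i) (z i))
        = (\<Prod>i<p. if i \<in> J then cubic_bspline (d i) (digit ?R r i) (z i) else 1)"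
      using assms(2) by (simp add: prod.If_cases Int_absorb1)
    have "vec_index (effect_matrix p d J *\<^sub>v b) r
        = (\<Sum>c<?D. index_mat (effect_matrix p d J) (r, c) * vec_index b c)"
      using r b effect_matrix_carrier[of p d J] by (auto simp: scalar_prod_def atLeast0LessThan)
    also have "\<dots> = (\<Sum>c<?D. vec_index b c
        * (\<Prod>i<p. if i \<in> J then of_bool (digit ?R r i = e c i) else A c i))"
      by (rule sum.cong) (use r pos in \<open>simp_all add: index_effect_matrix e_def A_def mult.commute cong: if_cong\<close>)
    finally show ?thesis
      unfolding J
      by (simp add: sum_distrib_right mult.assoc flip: prod.distrib)
        (auto intro!: sum.cong prod.cong simp: g_def)
  qed
  then have "(\<Sum>r<prod_list ?R. vec_index (effect_matrix p d J *\<^sub>v b) r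
        * (\<Prod>i\<in>J. cubic_bspline (d i) (digit ?R r i) (z i)))
      = (\<Sum>r<prod_list ?R. \<Sum>c<?D. vec_index b c * (\<Prod>i<p. g c i (digit ?R r i)))"
    by simp
  also have "\<dots> = (\<Sum>c<?D. vec_index b c * (\<Sum>r<prod_list ?R. \<Prod>i<length ?R. g c i (digit ?R r i)))"
    by (subst sum.swap) (simp add: sum_distrib_left length_effect_dims)
  also have "\<dots> = (\<Sum>c<?D. vec_index b c * (\<Prod>i<p. \<Sum>m<?R ! i. g c i m))"
    unfolding sum_prod_digit by (simp add: length_effect_dims)
  also have "\<dots> = (\<Sum>c<?D. vec_index b c
      * (\<Prod>i<p. if i \<in> J then cubic_bspline (d i) (e c i) (z i) else A c i))"
  proof (intro sum.cong arg_cong2[where f = "(*)"] prod.cong refl)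
    fix c i assume "i \<in> {..<p}"
    \<comment> \<open>This bound keeps \<open>e c i\<close> in the range of summation, so the delta
      selects exactly one term. Outside \<open>J\<close> the sum has the single term
      \<open>m = 0\<close>.\<close>
    moreover from this have "e c i < d i"
      using pos digit_less[of "map d [0..<p]" i c] by (simp add: e_def)
    ultimately show "(\<Sum>m<?R ! i. g c i m) = (if i \<in> J then cubic_bspline (d i) (e c i) (z i) else A c i)"
      by (simp add: nth_effect_dims g_def of_bool_def if_distrib[of "\<lambda>x. x * _"] cong: if_cong)
  qed
  also have "\<dots> = cube_integral ({..<p} - J) (\<lambda>y. f (\<lambda>i. if i \<in> J then z i else y i))"
    using cube_integral_tp_spline[where z = z, OF assms(1-3)] by (simp add: e_def A_def cong: if_cong)
  finally show ?thesis ..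
qed

subsection \<open>Linear independence of the B-splines\<close>

text \<open>\<open>u\<close> is the local coordinate on the knot interval number \<open>m\<close>.\<close>

lemma cubic_bspline_uniform:
  fixes a h u :: real and m i :: nat
  assumes "0 < h" and "0 \<le> u" and "u < 1"
  defines "t \<equiv> \<lambda>i. a + real i * h"
  defines "x \<equiv> a + (real m + u) * h"
  shows "bspline t 3 i x = (if i = m then u^3 / 6 else if i + 1 = m then (1 + 3 * u + 3 * u^2 - 3 * u^3) / 6
      else if i + 2 = m then (4 - 6 * u^2 + 3 * u^3) / 6 else if i + 3 = m then (1 - u)^3 / 6 else 0)"
proof -
  \<comment> \<open>In units of \<open>h\<close> the knots are consecutive integers, so
    \<open>a\<close> and \<open>h\<close> cancel. The separate \<open>k'\<close> allows numerals as
    degrees.\<close>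
  have rec: "bspline t k' i x = (real m - real i + u) / real (k + 1) * bspline t k i x
      + (real i + real k + 2 - real m - u) / real (k + 1) * bspline t k (i + 1) x"
    if "k' = Suc k" for k k' i
  proof -
    have "(x - t i) / (t (i + k + 1) - t i) = (h * (real m - real i + u)) / (h * real (k + 1))"
      by (simp add: t_def x_def algebra_simps)
    moreover have "(t (i + k + 2) - x) / (t (i + k + 2) - t (i + 1))
        = (h * (real i + real k + 2 - real m - u)) / (h * real (k + 1))"
      by (simp add: t_def x_def algebra_simps)
    ultimately show ?thesis
      using assms(1) unfolding that bspline_Suc by (simp only: mult_divide_mult_cancel_left_if) simp
  qed
  \<comment> \<open>Knot intervals are half-open and 0 \<le> u < 1, so \<open>x\<close> lies in
    interval \<open>m\<close> only.\<close>
  have 0: "bspline t 0 i x = (if i = m then 1 else 0)" for i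
  proof -
    have "t i \<le> x \<longleftrightarrow> real i \<le> real m + u"
      using assms(1) by (simp add: t_def x_def)
    moreover have "x < t (i + 1) \<longleftrightarrow> real m + u < 1 + real i"
      using assms(1) by (simp add: t_def x_def)
    moreover have "real i \<le> real m + u \<and> real m + u < 1 + real i \<longleftrightarrow> i = m"
    proof
      assume "real i \<le> real m + u \<and> real m + u < 1 + real i"
      then have "real i < real (Suc m)" "real m < real (Suc i)"
        using assms(2,3) unfolding of_nat_Suc by linarith+
      then show "i = m"
        unfolding of_nat_less_iff by simp
    qed (use assms(2,3) in simp)
    ultimately show ?thesis
      unfolding bspline.simps by (simp only:)
  qed
  have 1: "bspline t 1 i x = (if i = m then u else if i + 1 = m then 1 - u else 0)" for i
  proof -
    consider "m = i" | "m = i + 1" | "i \<noteq> m" "i + 1 \<noteq> m" by metis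
    then show ?thesis
      by cases (simp_all add: rec[of "Suc 0" 0 i] 0 del: bspline.simps)
  qed
  \<comment> \<open>In degree \<open>k\<close> only the indices with
    \<open>i \<le> m \<le> i + k\<close> contribute, which determines the case distinctions.\<close>
  have 2: "bspline t 2 i x = (if i = m then u^2 / 2 else if i + 1 = m then (1 + 2 * u - 2 * u^2) / 2
      else if i + 2 = m then (1 - u)^2 / 2 else 0)" for i
  proof -
    consider "m = i" | "m = i + 1" | "m = i + 2" | "i \<noteq> m" "i + 1 \<noteq> m" "i + 2 \<noteq> m" by metis
    then show ?thesis
      by cases (simp_all add: rec[of 2 "Suc 0" i] 1[unfolded One_nat_def], simp_all add: field_simps power2_eq_square)
  qed
  consider "m = i" | "m = i + 1" | "m = i + 2" | "m = i + 3" | "i \<noteq> m" "i + 1 \<noteq> m" "i + 2 \<noteq> m" "i + 3 \<noteq> m"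
    by metis
  then show ?thesis
    by cases (simp_all add: rec[of 3 2 i] 2, simp_all add: field_simps power2_eq_square power3_eq_cube)
qed

text \<open>Index \<open>l\<close> is among the four consecutive indices active on some knot
  interval inside the unit interval, where the combination is a cubic polynomial in
  \<open>u\<close>.\<close>

lemma cubic_bspline_independent:
  assumes "4 \<le> d" and zero: "\<And>x. x \<in> {0..1} \<Longrightarrow> (\<Sum>l<d. a l * cubic_bspline d l x) = 0" and "l < d"
  shows "a l = 0"
proof -
  define h where "h = 1 / (real d - 3)"
  have h: "0 < h" using assms(1) by (simp add: h_def)
  have knot: "knot d = (\<lambda>i. - 3 * h + real i * h)"
    by (simp add: fun_eq_iff knot_def h_def diff_divide_distrib)
  \<comment> \<open>For \<open>l \<le> 3\<close> this is 0, otherwise \<open>l - 3\<close>; since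
    \<open>d \<ge> 4\<close>, the interval stays left of 1.\<close>
  define n where "n = max 3 l - 3"
  have n: "n + 3 < d" "l \<in> {n, n + 1, n + 2, n + 3}"
    using assms(1,3) by (auto simp: n_def)
  have eq: "a n * ((1 - u)^3 / 6) + a (n + 1) * ((4 - 6 * u^2 + 3 * u^3) / 6)
      + a (n + 2) * ((1 + 3 * u + 3 * u^2 - 3 * u^3) / 6) + a (n + 3) * (u^3 / 6) = 0"
    if u: "0 \<le> u" "u < 1" for u
  proof -
    define x where "x = - 3 * h + (real (n + 3) + u) * h"
    have B: "cubic_bspline d l x = (if l = n + 3 then u^3 / 6
      else if l + 1 = n + 3 then (1 + 3 * u + 3 * u^2 - 3 * u^3) / 6
      else if l + 2 = n + 3 then (4 - 6 * u^2 + 3 * u^3) / 6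
      else if l + 3 = n + 3 then (1 - u)^3 / 6 else 0)" for l
      unfolding cubic_bspline_def knot x_def by (rule cubic_bspline_uniform[OF h u])
    \<comment> \<open>Three knots precede 0, so knot number \<open>n + 3\<close> is
      \<open>n * h\<close>.\<close>
    have x: "x = (real n + u) * h" by (simp add: x_def algebra_simps)
    have "real n + u \<le> real d - 3" using n(1) u by linarith
    then have "x \<in> {0..1}"
      using u h unfolding x by (simp add: h_def)
    then have "0 = (\<Sum>l<d. a l * cubic_bspline d l x)"
      using zero by simp
    also have "\<dots> = (\<Sum>l\<in>{n, n + 1, n + 2, n + 3}. a l * cubic_bspline d l x)"
      using n(1) by (intro sum.mono_neutral_right) (auto simp: B)
    also have "\<dots> = a n * ((1 - u)^3 / 6) + a (n + 1) * ((4 - 6 * u^2 + 3 * u^3) / 6)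
      + a (n + 2) * ((1 + 3 * u + 3 * u^2 - 3 * u^3) / 6) + a (n + 3) * (u^3 / 6)"
      by (simp add: B)
    finally show ?thesis ..
  qed
  \<comment> \<open>Four distinct points determine a cubic. They avoid \<open>u = 1\<close>, which
    belongs to the next half-open interval.\<close>
  have "a n = 0 \<and> a (n + 1) = 0 \<and> a (n + 2) = 0 \<and> a (n + 3) = 0"
    using eq[of 0] eq[of "1/4"] eq[of "1/2"] eq[of "3/4"]
    by (simp add: power2_eq_square power3_eq_cube)
  then show ?thesis using n(2) by auto
qed

section \<open>Independence of bivariate products\<close>

lemma tp_bspline2_eq:
  "i < d * e \<Longrightarrow> tp_bspline2 d e i (s, t) = cubic_bspline d (i div e) s * cubic_bspline e (i mod e) t"
  by (cases "e = 0") (simp_all add: tp_bspline2_def product_nth less_mult_imp_div_less)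

text \<open>For fixed \<open>t\<close> the inner sums are coefficients of a vanishing combination in
  \<open>s\<close>, hence 0; letting \<open>t\<close> vary, independence in the second variable
  finishes.\<close>

lemma tp_bspline2_independent:
  assumes "4 \<le> d" and "4 \<le> e"
    and zero: "\<And>x. x \<in> {0..1} \<times> {0..1} \<Longrightarrow> (\<Sum>l<d * e. a l * tp_bspline2 d e l x) = 0" and "l < d * e"
  shows "a l = 0"
proof -
  have eq: "(\<Sum>q<d. (\<Sum>m<e. a (q * e + m) * cubic_bspline e m t) * cubic_bspline d q s) = 0"
    if "s \<in> {0..1}" "t \<in> {0..1}" for s t
  proof -
    have "0 = (\<Sum>l<d * e. a l * tp_bspline2 d e l (s, t))"
      using zero[of "(s, t)"] that by simp
    also have "\<dots> = (\<Sum>l<d * e. a (l div e * e + l mod e)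
        * (cubic_bspline d (l div e) s * cubic_bspline e (l mod e) t))"
      by (simp add: tp_bspline2_eq)
    also have "\<dots> = (\<Sum>q<d. \<Sum>m<e. a (q * e + m) * (cubic_bspline d q s * cubic_bspline e m t))"
      by (rule sum_lessThan_mult)
    finally show ?thesis
      by (simp add: sum_distrib_right sum_distrib_left mult_ac)
  qed
  have l: "l div e < d" "l mod e < e"
    using assms by (auto simp: less_mult_imp_div_less)
  have "(\<Sum>m<e. a (l div e * e + m) * cubic_bspline e m t) = 0" if "t \<in> {0..1}" for t
    by (rule cubic_bspline_independent[OF assms(1) eq l(1)]) (use that in auto)
  then have "a (l div e * e + l mod e) = 0"
    by (rule cubic_bspline_independent[OF assms(2) _ l(2)])
  then show ?thesis by simp
qed

section \<open>Coefficients of the effects and their uniqueness\<close>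

text \<open>The difference of two expansions is a vanishing combination. Independence enters as a
  premise so that both bases are covered.\<close>

lemma has_coefficients_onI:
  assumes c: "expansion_on S n B g c"
    and indep: "\<And>a l. (\<And>x. x \<in> S \<Longrightarrow> (\<Sum>l<n. a l * B l x) = 0) \<Longrightarrow> l < n \<Longrightarrow> a l = 0"
  shows "in_span_on S n B g \<and> has_coefficients_on S n B g c"
proof -
  have "c' = c" if c': "expansion_on S n B g c'" for c'
  proof -
    have "(\<Sum>l<n. (vec_index c' l - vec_index c l) * B l x) = 0" if "x \<in> S" for x
      using c c' that by (simp add: expansion_on_def left_diff_distrib sum_subtractf)
    then have "vec_index c' l = vec_index c l" if "l < n" for l
      using indep[of "\<lambda>l. vec_index c' l - vec_index c l" l] that by simp
    then show ?thesis
      using c c' by (intro eq_vecI) (auto simp: expansion_on_def)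
  qed
  then show ?thesis
    using c unfolding in_span_on_def has_coefficients_on_def by blast
qed

theorem corollary4p3:
  fixes p :: nat and d :: "nat \<Rightarrow> nat"
    and f :: "(nat \<Rightarrow> real) \<Rightarrow> real" and b :: "real Matrix.vec"
  assumes "p \<ge> 2"
    and "\<And>j. j < p \<Longrightarrow> d j \<ge> 4"
    and "expansion_on (unit_cube {..<p}) (\<Prod>j<p. d j) (tp_bspline p d) f b"
  shows "(\<forall>j<p.
            in_span_on {0..1} (d j) (cubic_bspline (d j)) (main_effect p f j)
          \<and> has_coefficients_on {0..1} (d j) (cubic_bspline (d j)) (main_effect p f j)
              (effect_matrix p d {j} *\<^sub>v b))
       \<and> (\<forall>j k. j < k \<and> k < p \<longrightarrow>
            in_span_on ({0..1} \<times> {0..1}) (d j * d k) (tp_bspline2 (d j) (d k)) (interaction p f j k)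
          \<and> has_coefficients_on ({0..1} \<times> {0..1}) (d j * d k) (tp_bspline2 (d j) (d k))
              (interaction p f j k) (effect_matrix p d {j, k} *\<^sub>v b))"
proof (intro conjI[OF allI allI] impI allI)
  note f = assms(3)
  have pos: "0 < d i" if "i < p" for i
    using assms(2)[OF that] by simp
  show "in_span_on {0..1} (d j) (cubic_bspline (d j)) (main_effect p f j)
      \<and> has_coefficients_on {0..1} (d j) (cubic_bspline (d j)) (main_effect p f j)
          (effect_matrix p d {j} *\<^sub>v b)" if j: "j < p" for j
  proof (rule has_coefficients_onI)
    let ?R = "effect_dims p d {j}"
    have R: "prod_list ?R = d j"
      using j by (simp add: effect_dims_def prod_list_map_upt prod.If_cases)
    \<comment> \<open>All radices except that of \<open>j\<close> are 1, so digit \<open>j\<close>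
      has weight 1 and is the whole index.\<close>
    have dig: "digit ?R r j = r" if "r < d j" for r
      using that j by (simp add: digit_def prod_list_drop_effect_dims nth_effect_dims)
    have "main_effect p f j t = (\<Sum>r<d j. vec_index (effect_matrix p d {j} *\<^sub>v b) r * cubic_bspline (d j) r t)"
      if t: "t \<in> {0..1}" for t
    proof -
      have "(\<lambda>i. if i \<in> {j} then t else y i) = y(j := t)" for y :: "nat \<Rightarrow> real"
        by auto
      then show ?thesis
        using effect_expansion[OF f, of "{j}" "\<lambda>_. t"] j t pos dig by (simp add: main_effect_def R)
    qed
    then show "expansion_on {0..1} (d j) (cubic_bspline (d j)) (main_effect p f j)
        (effect_matrix p d {j} *\<^sub>v b)"
      using mult_mat_vec_carrier[OF effect_matrix_carrier[of p d "{j}"]] f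
      by (simp add: expansion_on_def R)
  qed (rule cubic_bspline_independent[OF assms(2)[OF j]])
  show "in_span_on ({0..1} \<times> {0..1}) (d j * d k) (tp_bspline2 (d j) (d k)) (interaction p f j k)
      \<and> has_coefficients_on ({0..1} \<times> {0..1}) (d j * d k) (tp_bspline2 (d j) (d k))
          (interaction p f j k) (effect_matrix p d {j, k} *\<^sub>v b)" if jk: "j < k \<and> k < p" for j k
  proof (rule has_coefficients_onI)
    let ?R = "effect_dims p d {j, k}"
    have "{0..<p} \<inter> {j, k} = {j, k}"
      using jk by auto
    then have R: "prod_list ?R = d j * d k"
      using jk prod_list_drop_effect_dims[of 0 p d "{j, k}"] by simp
    \<comment> \<open>As \<open>j < k\<close>, digit \<open>k\<close> has weight 1 and digit
      \<open>j\<close> has weight \<open>d k\<close>, which matches the order of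
      \<open>tp_bspline2\<close>.\<close>
    have dig: "digit ?R r j = r div d k" "digit ?R r k = r mod d k" if "r < d j * d k" for r
    proof -
      have "{Suc j..<p} \<inter> {j, k} = {k}" "{Suc k..<p} \<inter> {j, k} = {}"
        using jk by auto
      moreover have "r div d k < d j"
        using that by (simp add: less_mult_imp_div_less)
      ultimately show "digit ?R r j = r div d k" "digit ?R r k = r mod d k"
        unfolding digit_def prod_list_drop_effect_dims using jk by (simp_all add: nth_effect_dims)
    qed
    have "interaction p f j k (s, t)
        = (\<Sum>r<d j * d k. vec_index (effect_matrix p d {j, k} *\<^sub>v b) r * tp_bspline2 (d j) (d k) r (s, t))"
      if st: "s \<in> {0..1}" "t \<in> {0..1}" for s t
    proof -
      let ?z = "\<lambda>i. if i = j then s else t"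
      \<comment> \<open>Because \<open>j\<close> and \<open>k\<close> differ, the second update does
        not overwrite the first.\<close>
      have "(\<lambda>i. if i \<in> {j, k} then ?z i else y i) = y(j := s, k := t)" for y :: "nat \<Rightarrow> real"
        using jk by auto
      then show ?thesis
        using effect_expansion[OF f, of "{j, k}" ?z] jk st pos dig
        by (simp add: interaction_def R tp_bspline2_eq)
    qed
    then show "expansion_on ({0..1} \<times> {0..1}) (d j * d k) (tp_bspline2 (d j) (d k))
        (interaction p f j k) (effect_matrix p d {j, k} *\<^sub>v b)"
      using mult_mat_vec_carrier[OF effect_matrix_carrier[of p d "{j, k}"]] f
      by (auto simp: expansion_on_def R)
  qed (rule tp_bspline2_independent[OF assms(2) assms(2)]; use jk in simp)
qed

end
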